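(* Let $p,q\ge1$ be integers and $x\in[-1,1)$. Then \[\int_0^x\frac{\mathrm{Li}_p(t)\mathrm{Li}_q(t)}{t}\,dt=\sum_{i=1}^{q-1}(-1)^{i-1}\mathrm{Li}_{p+i}(x)\mathrm{Li}_{q+1-i}(x)+(-1)^q\ln(1-x)\bigl(\mathrm{Li}_{p+q}(x)-\zeta(p+q)\bigr)-(-1)^q\sum_{n=1}^\infty\frac{1}{n^{p+q}}\left(\sum_{k=1}^n\frac{x^k}{k}\right).\]
   Context: $\mathrm{Li}_p(x)=\sum_{n\ge1}x^n/n^p$ for $|x|\le1$ (with $\mathrm{Li}_1(x)=-\ln(1-x)$); $\zeta(s)=\sum_{n\ge1}n^{-s}$. An empty sum is zero. *)

theory Defs
  imports "HOL-Analysis.Analysis"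
begin

text \<open>The series is the limit of its partial sums taken in order, so that conditional convergence
  (\<open>p = 1\<close>, \<open>x = -1\<close>) is covered. It is meaningful for \<open>\<bar>x\<bar> \<le> 1\<close> except at
  \<open>p = 1\<close>, \<open>x = 1\<close>, where it diverges.\<close>

definition Li :: "nat \<Rightarrow> real \<Rightarrow> real" where
  "Li p x = (\<Sum>n. x ^ Suc n / real (Suc n) ^ p)"

lemma Li_1:
  assumes "-1 \<le> x" "x < 1"
  shows "Li 1 x = - ln (1 - x)"
proof (cases "x = -1")
  case True
  have "(\<lambda>k. - ((-1) ^ k / real (Suc k))) sums - ln (2::real)"
    by (intro sums_minus alternating_harmonic_series_sums)
  then show ?thesis
    unfolding Li_def True by (simp add: sums_iff)
next
  case False
  with assms have x: "\<bar>x\<bar> < 1" by simp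
  have "ln (1 - x) = (\<Sum>n. (-1) ^ n * (1 / real (n + 1)) * ((1 - x) - 1) ^ Suc n)"
    using x by (intro ln_series) auto
  also have "\<dots> = (\<Sum>n. - (x ^ Suc n / real (Suc n) ^ 1))"
    by (intro suminf_cong) (simp add: power_minus[of x])
  also have "\<dots> = - Li 1 x"
  proof -
    have "summable (\<lambda>n. x ^ Suc n / real (Suc n) ^ 1)"
    proof (rule summable_comparison_test')
      show "summable (\<lambda>n. \<bar>x\<bar> ^ n)" using x by (intro summable_geometric) simp
      show "norm (x ^ Suc n / real (Suc n) ^ 1) \<le> \<bar>x\<bar> ^ n" if "n \<ge> 0" for n
      proof -
        have "\<bar>x\<bar> * \<bar>x\<bar> ^ n \<le> 1 * \<bar>x\<bar> ^ n" using x by (intro mult_right_mono) auto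
        moreover have "\<bar>x\<bar> ^ n * 1 \<le> \<bar>x\<bar> ^ n * real (Suc n)" by (intro mult_left_mono) auto
        ultimately show ?thesis
          by (simp add: abs_mult power_abs divide_le_eq del: of_nat_Suc)
      qed
    qed
    then show ?thesis unfolding Li_def by (rule suminf_minus)
  qed
  finally show ?thesis by simp
qed

definition zeta :: "real \<Rightarrow> real" where
  "zeta s = (\<Sum>n. real (Suc n) powr (- s))"

end

theory Submission
  imports Defs
begin

text \<open>Since \<open>Li q t / t\<close> tends to 1 and \<open>Li p t\<close> to 0 at the origin, the integrand is continuous on
  \<open>[-1, 1)\<close>, its junk value \<open>0 / 0 = 0\<close> being the correct limit. So it is enough that the right-hand
  side \<open>F p q\<close> is continuous there, vanishes at 0 and has the right derivative inside. By
  \<open>Li (m + 1)' t = Li m t / t\<close>, the recurrence \<open>F p (q + 1) = Li (p + 1) * Li (q + 1) - F (p + 1) q\<close>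
  reduces this to \<open>q = 1\<close>. There the nested sum has derivative \<open>(zeta m - Li m t) / (1 - t)\<close> with
  \<open>m = p + 1\<close>, a sum of geometric sums, which cancels against the derivative of the logarithm.\<close>

section \<open>Polylogarithms on $[-1,1)$\<close>

lemma Li_0 [simp]: "Li p 0 = 0"
  by (simp add: Li_def)

lemma summable_inverse_Suc_power:
  assumes "m \<ge> 2"
  shows "summable (\<lambda>n. 1 / real (Suc n) ^ m)"
  using inverse_power_summable[OF assms, where 'a = real]
  by (subst summable_Suc_iff) (simp add: inverse_eq_divide)

lemma norm_Li_term_le:
  fixes x :: real
  assumes "\<bar>x\<bar> \<le> 1"
  shows "norm (x ^ Suc n / real (Suc n) ^ m) \<le> 1 / real (Suc n) ^ m"
proof -
  have "\<bar>x\<bar> ^ Suc n \<le> 1" using assms by (intro power_le_one) auto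
  then show ?thesis by (simp add: power_abs abs_mult divide_right_mono del: of_nat_Suc)
qed

lemma summable_Li:
  assumes "m \<ge> 2" "\<bar>x\<bar> \<le> 1"
  shows "summable (\<lambda>n. x ^ Suc n / real (Suc n) ^ m)"
  using norm_Li_term_le[OF assms(2)]
  by (intro summable_comparison_test'[OF summable_inverse_Suc_power[OF assms(1)]])

lemma continuous_on_suminf:
  fixes f :: "nat \<Rightarrow> 'a::topological_space \<Rightarrow> 'b::banach"
  assumes "\<And>n. continuous_on A (f n)"
    and "\<And>n x. x \<in> A \<Longrightarrow> norm (f n x) \<le> M n" and "summable M"
  shows "continuous_on A (\<lambda>x. \<Sum>n. f n x)"
proof (rule uniform_limit_theorem)
  show "uniform_limit A (\<lambda>n x. \<Sum>i<n. f i x) (\<lambda>x. \<Sum>n. f n x) sequentially"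
    using assms(2,3) by (rule Weierstrass_m_test)
  show "\<forall>\<^sub>F n in sequentially. continuous_on A (\<lambda>x. \<Sum>i<n. f i x)"
    by (intro always_eventually allI continuous_on_sum assms(1))
qed simp

text \<open>For \<open>m \<ge> 2\<close> the M-test applies on all of \<open>[-1, 1]\<close>. For
  \<open>m = 1\<close> its majorant is the divergent harmonic series, so the closed form of
  \<open>Li 1\<close> takes over.\<close>

lemma continuous_on_Li:
  assumes "m \<ge> 1"
  shows "continuous_on {-1..<1} (Li m)"
proof (cases "m = 1")
  case True
  have "continuous_on {-1..<1} (\<lambda>x::real. - ln (1 - x))"
    by (intro continuous_intros) auto
  then show ?thesis
    by (rule continuous_on_eq) (simp add: True Li_1[symmetric])
next
  case False
  with assms have "m \<ge> 2" by simp
  show ?thesis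
    unfolding Li_def
  proof (rule continuous_on_suminf[OF _ norm_Li_term_le summable_inverse_Suc_power[OF \<open>m \<ge> 2\<close>]])
    show "continuous_on {-1..<1} (\<lambda>x::real. x ^ Suc n / real (Suc n) ^ m)" for n
      by (intro continuous_intros) auto
  qed auto
qed

lemma DERIV_pow_Suc_divide:
  "((\<lambda>x::real. x ^ Suc n / real (Suc n)) has_real_derivative x ^ n) (at x within A)"
  using DERIV_cdivide[OF DERIV_pow[of "Suc n" x A], of "real (Suc n)"] by (simp del: of_nat_Suc)

text \<open>Termwise differentiation. The derivative is left as a power series instead of
  \<open>Li m x / x\<close> so that the point 0 is included.\<close>

lemma Li_has_derivative_powser:
  fixes x :: real
  assumes "\<bar>x\<bar> < 1"
  shows "(Li (Suc m) has_real_derivative (\<Sum>n. x ^ n / real (Suc n) ^ m)) (at x)"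
  unfolding Li_def
proof (rule has_field_derivative_series')
  \<comment> \<open>With \<open>r\<close> midway between \<open>\<bar>x\<bar>\<close> and 1,
    \<open>x\<close> is interior to \<open>[-r, r]\<close> and the geometric series in
    \<open>r\<close> dominates the differentiated series there.\<close>
  define r where "r = (\<bar>x\<bar> + 1) / 2"
  have r: "0 < r" "r < 1" "\<bar>x\<bar> < r" using assms by (auto simp: r_def)
  show "convex {-r..r}" by simp
  show "x \<in> interior {-r..r}" using r by auto
  show "0 \<in> {-r..r}" using r by simp
  show "summable (\<lambda>n. 0 ^ Suc n / real (Suc n) ^ Suc m)" by simp
  show "((\<lambda>y. y ^ Suc n / real (Suc n) ^ Suc m) has_real_derivative y ^ n / real (Suc n) ^ m)
      (at y within {-r..r})" for n y
    using DERIV_cdivide[OF DERIV_pow_Suc_divide[of n y "{-r..r}"], of "real (Suc n) ^ m"]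
    by (simp add: divide_divide_eq_left del: of_nat_Suc)
  show "uniformly_convergent_on {-r..r} (\<lambda>N y. \<Sum>n<N. y ^ n / real (Suc n) ^ m)"
  proof (rule Weierstrass_m_test')
    show "summable (\<lambda>n. r ^ n)" using r by (intro summable_geometric) auto
    fix n and y :: real assume y: "y \<in> {-r..r}"
    have "\<bar>y\<bar> ^ n / real (Suc n) ^ m \<le> \<bar>y\<bar> ^ n / 1"
      by (intro divide_left_mono one_le_power) auto
    also have "\<dots> \<le> r ^ n" using y by (simp, intro power_mono) auto
    finally show "norm (y ^ n / real (Suc n) ^ m) \<le> r ^ n"
      by (simp add: power_abs)
  qed
qed

lemma Li_has_derivative:
  assumes "\<bar>x\<bar> < 1" "x \<noteq> 0" "m \<ge> 1"
  shows "(Li (Suc m) has_real_derivative Li m x / x) (at x)"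
proof -
  have "summable (\<lambda>n. x ^ n / real (Suc n) ^ m)"
  proof (rule summable_comparison_test')
    show "summable (\<lambda>n. \<bar>x\<bar> ^ n)" using assms by (intro summable_geometric) auto
    have "\<bar>x\<bar> ^ n / real (Suc n) ^ m \<le> \<bar>x\<bar> ^ n / 1" for n
      by (intro divide_left_mono one_le_power) auto
    then show "norm (x ^ n / real (Suc n) ^ m) \<le> \<bar>x\<bar> ^ n" if "n \<ge> 0" for n
      by (simp add: power_abs)
  qed
  from suminf_mult[OF this, of x] have "Li m x = x * (\<Sum>n. x ^ n / real (Suc n) ^ m)"
    by (simp add: Li_def)
  then show ?thesis
    using Li_has_derivative_powser[OF assms(1), of m] assms(2) by simp
qed

lemma continuous_on_Li_Li_div:
  assumes "p \<ge> 1" "q \<ge> 1"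
  shows "continuous_on {-1..<1} (\<lambda>t. Li p t * Li q t / t)"
proof -
  have "continuous (at t within {-1..<1}) (\<lambda>t. Li p t * Li q t / t)" if t: "t \<in> {-1..<1}" for t
  proof (cases "t = 0")
    case False
    have "continuous (at t within {-1..<1}) (Li m)" if "m \<ge> 1" for m
      using continuous_on_Li[OF that] t by (simp add: continuous_on_eq_continuous_within)
    then show ?thesis
      using False assms by (intro continuous_intros) auto
  next
    case True
    obtain p' q' where pq: "p = Suc p'" "q = Suc q'"
      using assms by (metis Suc_pred' less_eq_Suc_le One_nat_def)
    define c where "c = (\<Sum>n. (0::real) ^ n / real (Suc n) ^ q')"
    \<comment> \<open>As \<open>Li q 0 = 0\<close>, this is the difference quotient of
      \<open>Li q\<close> at 0. Any finite limit \<open>c\<close> suffices, since the other factor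
      tends to 0.\<close>
    have "((\<lambda>t. Li q t / t) \<longlongrightarrow> c) (at 0)"
      using Li_has_derivative_powser[of 0 q'] by (simp add: DERIV_def pq c_def)
    moreover have "(Li p \<longlongrightarrow> 0) (at 0)"
      using DERIV_isCont[OF Li_has_derivative_powser[of 0 p']] by (simp add: isCont_def pq)
    ultimately have "((\<lambda>t. Li p t * (Li q t / t)) \<longlongrightarrow> 0 * c) (at 0)"
      by (intro tendsto_mult)
    then have "isCont (\<lambda>t. Li p t * Li q t / t) 0"
      by (simp add: isCont_def)
    then show ?thesis
      unfolding True by (rule continuous_at_imp_continuous_at_within)
  qed
  then show ?thesis by (simp add: continuous_on_eq_continuous_within)
qed

section \<open>The nested sum\<close>

text \<open>Telescoping: \<open>1 / (n + 1)\<close> is at most twice the increment of the square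
  root from \<open>n\<close> to \<open>n + 1\<close>. This crude bound on harmonic numbers is
  enough, because \<open>n powr (1/2 - 2)\<close> is summable.\<close>

lemma sum_inverse_le_sqrt: "(\<Sum>k=1..n. 1 / real k) \<le> 2 * sqrt (real n)"
proof (induction n)
  case (Suc n)
  define a b where "a = sqrt (real n)" and "b = sqrt (real (Suc n))"
  have b: "b\<^sup>2 = real (Suc n)" "a\<^sup>2 = real n" "a \<ge> 0" "b \<ge> 1" "a \<le> b"
    by (auto simp: a_def b_def)
  \<comment> \<open>Uses \<open>b\<^sup>2 - a\<^sup>2 = 1\<close>; then \<open>a \<le> b\<close> and
    \<open>b \<ge> 1\<close> give \<open>b + a \<le> 2 * b \<le> 2 * b\<^sup>2\<close>, and dividing
    by \<open>b\<^sup>2 = Suc n\<close> yields the increment bound.\<close>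
  have "1 = (b - a) * (b + a)"
    using b by (simp add: algebra_simps power2_eq_square)
  also have "\<dots> \<le> (b - a) * (2 * b\<^sup>2)"
  proof (rule mult_left_mono)
    have "b * 1 \<le> b * b" using b by (intro mult_left_mono) auto
    then show "b + a \<le> 2 * b\<^sup>2" using b(5) unfolding power2_eq_square by linarith
  qed (use b in auto)
  finally have "1 / real (Suc n) \<le> 2 * (b - a)"
    unfolding b(1)[symmetric] using b(4) by (simp add: field_simps)
  with Suc.IH show ?case by (simp add: a_def b_def)
qed simp

text \<open>At \<open>x = 1\<close> and \<open>m \<ge> 2\<close> this is the classical Euler sum of
  harmonic numbers over \<open>n ^ m\<close>.\<close>

definition nested_sum :: "nat \<Rightarrow> real \<Rightarrow> real" where
  "nested_sum m x = (\<Sum>n. 1 / real (Suc n) ^ m * (\<Sum>k=1..Suc n. x ^ k / real k))"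

lemma nested_sum_0 [simp]: "nested_sum m 0 = 0"
proof -
  have "(\<Sum>k=1..n. 0 ^ k / real k) = 0" for n
    by (intro sum.neutral) auto
  then show ?thesis by (simp add: nested_sum_def)
qed

text \<open>The inner sum is bounded by a harmonic number, hence by a square root, and the outer
  factor by the inverse square. The bound is free of \<open>x\<close>, so it gives uniform
  convergence up to \<open>x = -1\<close>.\<close>

lemma norm_nested_sum_term_le:
  fixes x :: real
  assumes "m \<ge> 2" "\<bar>x\<bar> \<le> 1"
  shows "norm (1 / real (Suc n) ^ m * (\<Sum>k=1..Suc n. x ^ k / real k))
    \<le> 2 * real (Suc n) powr (-3/2)"
proof -
  have "\<bar>\<Sum>k=1..Suc n. x ^ k / real k\<bar> \<le> (\<Sum>k=1..Suc n. 1 / real k)"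
  proof (rule order_trans[OF sum_abs sum_mono])
    show "\<bar>x ^ k / real k\<bar> \<le> 1 / real k" for k
      using assms(2) by (simp add: power_abs power_le_one divide_right_mono)
  qed
  also note sum_inverse_le_sqrt
  finally have *: "\<bar>\<Sum>k=1..Suc n. x ^ k / real k\<bar> \<le> 2 * real (Suc n) powr (1/2)"
    by (simp only: powr_half_sqrt of_nat_0_le_iff)
  have "real (Suc n) ^ 2 \<le> real (Suc n) ^ m"
    using assms(1) by (intro power_increasing) auto
  then have "1 / real (Suc n) ^ m \<le> 1 / real (Suc n) ^ 2"
    by (intro divide_left_mono mult_pos_pos zero_less_power) auto
  also have "\<dots> = real (Suc n) powr (-2)"
    by (simp add: powr_minus powr_numeral divide_simps del: of_nat_Suc)
  finally have "\<bar>1 / real (Suc n) ^ m\<bar> \<le> real (Suc n) powr (-2)"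
    by (simp del: of_nat_Suc)
  from mult_mono[OF this *] show ?thesis
    by (simp add: abs_mult mult.left_commute flip: powr_add del: of_nat_Suc)
qed

lemma summable_nested_sum_bound: "summable (\<lambda>n. 2 * real (Suc n) powr (-3/2))"
  using summable_real_powr_iff[of "-3/2"]
  by (intro summable_mult) (subst summable_Suc_iff[of "\<lambda>n. real n powr (-3/2)"], simp)

lemma summable_nested_sum:
  assumes "m \<ge> 2" "\<bar>x\<bar> \<le> 1"
  shows "summable (\<lambda>n. 1 / real (Suc n) ^ m * (\<Sum>k=1..Suc n. x ^ k / real k))"
  using norm_nested_sum_term_le[OF assms]
  by (intro summable_comparison_test'[OF summable_nested_sum_bound])

lemma continuous_on_nested_sum:
  assumes "m \<ge> 2"
  shows "continuous_on {-1..<1} (nested_sum m)"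
  unfolding nested_sum_def
proof (rule continuous_on_suminf[OF _ norm_nested_sum_term_le summable_nested_sum_bound])
  show "continuous_on {-1..<1} (\<lambda>x. 1 / real (Suc n) ^ m * (\<Sum>k=1..Suc n. x ^ k / real k))" for n
    by (intro continuous_intros) auto
qed (use assms in auto)

lemma nested_sum_has_derivative:
  assumes m: "m \<ge> 2" and x: "\<bar>x\<bar> < 1"
  shows "(nested_sum m has_real_derivative (zeta (real m) - Li m x) / (1 - x)) (at x)"
proof -
  \<comment> \<open>The derivative of the n-th term: the inner sum differentiates to a geometric
    sum, written in closed form.\<close>
  define f' where "f' n y = 1 / real (Suc n) ^ m * ((1 - y ^ Suc n) / (1 - y))" for n and y :: real
  define r where "r = (\<bar>x\<bar> + 1) / 2"
  have r: "0 < r" "r < 1" "\<bar>x\<bar> < r" using x by (auto simp: r_def)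
  have "(nested_sum m has_real_derivative (\<Sum>n. f' n x)) (at x)"
    unfolding nested_sum_def
  proof (rule has_field_derivative_series')
    show "convex {-r..r}" by simp
    show "x \<in> interior {-r..r}" using r by auto
    show "0 \<in> {-r..r}" using r by simp
    show "summable (\<lambda>n. 1 / real (Suc n) ^ m * (\<Sum>k=1..Suc n. 0 ^ k / real k))"
      using m by (intro summable_nested_sum) auto
    fix n and y :: real assume y: "y \<in> {-r..r}"
    have deriv: "((\<lambda>y. \<Sum>k=1..Suc n. y ^ k / real k) has_real_derivative (\<Sum>k=1..Suc n. y ^ (k - 1)))
        (at y within {-r..r})"
    proof (rule DERIV_sum)
      \<comment> \<open>The index starts at 1, so the subtraction \<open>k - 1\<close> is not
        truncated.\<close>
      fix k assume "k \<in> {1..Suc n}"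
      then have "Suc (k - 1) = k" by simp
      then show "((\<lambda>y. y ^ k / real k) has_real_derivative y ^ (k - 1)) (at y within {-r..r})"
        using DERIV_pow_Suc_divide[of "k - 1" y "{-r..r}"] by (simp only:)
    qed
    have "(\<Sum>k=1..Suc n. y ^ (k - 1)) = (\<Sum>k<Suc n. y ^ k)"
      by (rule sum.reindex_bij_witness[of _ Suc "\<lambda>k. k - 1"]) auto
    then have geom: "(\<Sum>k=1..Suc n. y ^ (k - 1)) = (1 - y ^ Suc n) / (1 - y)"
      using y r sum_gp_strict[of y "Suc n"] by auto
    show "((\<lambda>y. 1 / real (Suc n) ^ m * (\<Sum>k=1..Suc n. y ^ k / real k))
        has_real_derivative f' n y) (at y within {-r..r})"
      unfolding f'_def by (rule DERIV_cmult[OF deriv[unfolded geom]])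
  next
    show "uniformly_convergent_on {-r..r} (\<lambda>N y. \<Sum>n<N. f' n y)"
    proof (rule Weierstrass_m_test')
      \<comment> \<open>On \<open>[-r, r]\<close> the numerator of the geometric sum is at most 2 in
        absolute value and its denominator is at least \<open>1 - r\<close>.\<close>
      show "summable (\<lambda>n. 1 / real (Suc n) ^ m * (2 / (1 - r)))"
        by (intro summable_mult2 summable_inverse_Suc_power m)
      fix n and y :: real assume y: "y \<in> {-r..r}"
      have "\<bar>y\<bar> ^ Suc n \<le> 1" using y r by (intro power_le_one) auto
      then have "\<bar>1 - y ^ Suc n\<bar> \<le> 2"
        by (simp only: power_abs[symmetric] abs_le_iff) linarith
      then have "\<bar>1 - y ^ Suc n\<bar> / \<bar>1 - y\<bar> \<le> 2 / (1 - r)"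
        using y r by (intro frac_le) auto
      then have "1 / real (Suc n) ^ m * (\<bar>1 - y ^ Suc n\<bar> / \<bar>1 - y\<bar>)
          \<le> 1 / real (Suc n) ^ m * (2 / (1 - r))"
        by (intro mult_left_mono) auto
      then show "norm (f' n y) \<le> 1 / real (Suc n) ^ m * (2 / (1 - r))"
        by (simp add: f'_def abs_mult del: of_nat_Suc power_Suc)
    qed
  qed
  also have "(\<Sum>n. f' n x) = (\<Sum>n. (1 / real (Suc n) ^ m - x ^ Suc n / real (Suc n) ^ m) / (1 - x))"
    by (simp add: f'_def diff_divide_distrib mult.commute del: of_nat_Suc power_Suc)
  also have "\<dots> = (\<Sum>n. 1 / real (Suc n) ^ m - x ^ Suc n / real (Suc n) ^ m) / (1 - x)"
    using m x by (intro suminf_divide summable_diff summable_inverse_Suc_power summable_Li) auto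
  also have "\<dots> = ((\<Sum>n. 1 / real (Suc n) ^ m) - Li m x) / (1 - x)"
    using m x unfolding Li_def
    by (subst suminf_diff) (auto intro: summable_inverse_Suc_power summable_Li simp del: of_nat_Suc power_Suc)
  also have "(\<Sum>n. 1 / real (Suc n) ^ m) = zeta (real m)"
    unfolding zeta_def
    by (intro suminf_cong) (simp add: powr_minus powr_realpow inverse_eq_divide del: of_nat_Suc)
  finally show ?thesis .
qed

section \<open>The antiderivative\<close>

text \<open>The part of the right-hand side that, up to sign, depends on \<open>p\<close> and
  \<open>q\<close> only through \<open>m = p + q\<close>.\<close>

definition Li_Li_tail :: "nat \<Rightarrow> real \<Rightarrow> real" where
  "Li_Li_tail m x = ln (1 - x) * (Li m x - zeta (real m)) - nested_sum m x"

definition Li_Li_primitive :: "nat \<Rightarrow> nat \<Rightarrow> real \<Rightarrow> real" where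
  "Li_Li_primitive p q x = (\<Sum>i=1..q-1. (-1) ^ (i - 1) * Li (p + i) x * Li (q + 1 - i) x)
    + (-1) ^ q * Li_Li_tail (p + q) x"

lemma Li_Li_primitive_1: "Li_Li_primitive p 1 x = - Li_Li_tail (Suc p) x"
  by (simp add: Li_Li_primitive_def)

text \<open>Integration by parts at the level of primitives. The term \<open>i = 1\<close> splits
  off and shifting the index flips the signs of the rest; \<open>p + q + 1\<close> is the same on
  both sides, so the tail only changes sign.\<close>

lemma Li_Li_primitive_Suc:
  assumes "q \<ge> 1"
  shows "Li_Li_primitive p (Suc q) x
    = Li (Suc p) x * Li (Suc q) x - Li_Li_primitive (Suc p) q x"
proof -
  define g where "g i = (-1) ^ (i - 1) * Li (p + i) x * Li (Suc q + 1 - i) x" for i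
  have "(\<Sum>i=1..q. g i) = g 1 + (\<Sum>i=Suc 1..q. g i)"
    using assms by (rule sum.atLeast_Suc_atMost)
  also have "(\<Sum>i=Suc 1..q. g i) = (\<Sum>i=1..q-1. g (Suc i))"
    using assms by (intro sum.reindex_bij_witness[of _ Suc "\<lambda>i. i - 1"]) auto
  also have "\<dots> = (\<Sum>i=1..q-1. - ((-1) ^ (i - 1) * Li (Suc p + i) x * Li (q + 1 - i) x))"
    by (intro sum.cong refl) (auto simp: g_def power_eq_if)
  finally show ?thesis
    by (simp add: Li_Li_primitive_def g_def sum_negf)
qed

lemma Li_Li_primitive_0: "q \<ge> 1 \<Longrightarrow> Li_Li_primitive p q 0 = 0"
  by (simp add: Li_Li_primitive_def Li_Li_tail_def)

lemma continuous_on_Li_Li_primitive: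
  assumes "p \<ge> 1" "q \<ge> 1"
  shows "continuous_on {-1..<1} (Li_Li_primitive p q)"
  unfolding Li_Li_primitive_def Li_Li_tail_def
  using assms by (intro continuous_intros continuous_on_Li continuous_on_nested_sum) auto

text \<open>Differentiating the logarithm gives \<open>(zeta - Li) / (1 - x)\<close>, which the
  nested sum cancels. What remains is \<open>ln (1 - x) * Li m x / x\<close>, where the logarithm is
  \<open>- Li 1 x\<close>.\<close>

lemma Li_Li_tail_has_derivative:
  assumes "\<bar>x\<bar> < 1" "x \<noteq> 0" "m \<ge> 1"
  shows "(Li_Li_tail (Suc m) has_real_derivative - (Li m x * Li 1 x / x)) (at x)"
proof -
  have x: "-1 < x" "x < 1" using assms by auto
  have ln: "((\<lambda>x. ln (1 - x)) has_real_derivative - (1 / (1 - x))) (at x)"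
    using x by (auto intro!: derivative_eq_intros)
  have Li: "((\<lambda>x. Li (Suc m) x - zeta (real (Suc m))) has_real_derivative Li m x / x - 0) (at x)"
    by (intro DERIV_diff DERIV_const Li_has_derivative assms)
  have sum: "(nested_sum (Suc m) has_real_derivative
      (zeta (real (Suc m)) - Li (Suc m) x) / (1 - x)) (at x)"
    using assms by (intro nested_sum_has_derivative) auto
  show ?thesis
    unfolding Li_Li_tail_def
    by (rule DERIV_cong[OF DERIV_diff[OF DERIV_mult[OF ln Li] sum]])
      (use x in \<open>simp add: Li_1[unfolded One_nat_def] diff_divide_distrib algebra_simps\<close>)
qed

lemma Li_Li_primitive_has_derivative:
  assumes "q \<ge> 1" "p \<ge> 1" "\<bar>x\<bar> < 1" "x \<noteq> 0"
  shows "(Li_Li_primitive p q has_real_derivative Li p x * Li q x / x) (at x)"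
  using assms(1,2)
\<comment> \<open>\<open>p\<close> is generalized because the recurrence trades a step in
  \<open>q\<close> for one in \<open>p\<close>. By the product rule the product contributes
  \<open>Li p * Li (q + 1) / x + Li (p + 1) * Li q / x\<close>, and the induction hypothesis removes
  the second summand.\<close>
proof (induction q arbitrary: p rule: dec_induct)
  case base
  have "((\<lambda>x. - Li_Li_tail (Suc p) x) has_real_derivative Li p x * Li 1 x / x) (at x)"
    using DERIV_minus[OF Li_Li_tail_has_derivative[of x p]] base assms(3,4) by simp
  then show ?case by (simp only: Li_Li_primitive_1[abs_def])
next
  case (step q)
  have "((\<lambda>x. Li (Suc p) x * Li (Suc q) x - Li_Li_primitive (Suc p) q x)
      has_real_derivative Li p x * Li (Suc q) x / x) (at x)"
    using step.hyps step.prems assms(3,4)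
    by (auto intro!: derivative_eq_intros step.IH Li_has_derivative simp: field_simps)
  moreover have "Li_Li_primitive p (Suc q)
      = (\<lambda>x. Li (Suc p) x * Li (Suc q) x - Li_Li_primitive (Suc p) q x)"
    using step.hyps by (intro ext Li_Li_primitive_Suc)
  ultimately show ?case by (simp only:)
qed

text \<open>Differentiability is asked only in the open interval: the derivative of the primitive
  has been computed neither at 0 nor at -1, and both can occur as endpoints.\<close>

lemma interval_integral_FTC_interior:
  fixes a b :: real and f F :: "real \<Rightarrow> real"
  assumes "a \<le> b" "continuous_on {a..b} f" "continuous_on {a..b} F"
    and "\<And>t. a < t \<Longrightarrow> t < b \<Longrightarrow> (F has_real_derivative f t) (at t)"
  shows "(LBINT t=a..b. f t) = F b - F a"
proof -
  have "(f has_integral (F b - F a)) {a..b}"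
    using assms
    by (intro fundamental_theorem_of_calculus_interior)
      (auto simp: has_real_derivative_iff_has_vector_derivative)
  moreover have "(LBINT t=a..b. f t) = integral {a..b} f"
    using assms by (intro interval_integral_eq_integral borel_integrable_atLeastAtMost')
  ultimately show ?thesis by (simp add: integral_unique)
qed

theorem theorem2p2:
  fixes p q :: nat and x :: real
  assumes "p \<ge> 1" and "q \<ge> 1" and "-1 \<le> x" and "x < 1"
  shows "interval_lebesgue_integrable lborel 0 (ereal x) (\<lambda>t. Li p t * Li q t / t)
    \<and> summable (\<lambda>n. 1 / real (Suc n) ^ (p + q) * (\<Sum>k=1..Suc n. x ^ k / real k))
    \<and> (LBINT t=0..ereal x. Li p t * Li q t / t) =
        (\<Sum>i=1..q-1. (-1) ^ (i - 1) * Li (p + i) x * Li (q + 1 - i) x)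
        + (-1) ^ q * ln (1 - x) * (Li (p + q) x - zeta (real (p + q)))
        - (-1) ^ q * (\<Sum>n. 1 / real (Suc n) ^ (p + q) * (\<Sum>k=1..Suc n. x ^ k / real k))"
proof (intro conjI)
  let ?f = "\<lambda>t. Li p t * Li q t / t" and ?F = "Li_Li_primitive p q"
  have cont: "continuous_on {a..b} ?f" "continuous_on {a..b} ?F" if "-1 \<le> a" "b < 1" for a b
    using that assms(1,2)
    by (auto intro: continuous_on_subset[OF continuous_on_Li_Li_div]
        continuous_on_subset[OF continuous_on_Li_Li_primitive])
  show "interval_lebesgue_integrable lborel 0 (ereal x) ?f"
  proof (cases "0 \<le> x")
    case True
    then show ?thesis
      using interval_integrable_continuous_on[OF _ cont(1), of 0 x] assms by (simp add: zero_ereal_def)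
  next
    case False
    then show ?thesis
      using interval_integrable_continuous_on[OF _ cont(1), of x 0] assms
      by (subst interval_integrable_endpoints_reverse) (simp add: zero_ereal_def)
  qed
  show "summable (\<lambda>n. 1 / real (Suc n) ^ (p + q) * (\<Sum>k=1..Suc n. x ^ k / real k))"
    using assms by (intro summable_nested_sum) auto
  have "(LBINT t=0..ereal x. ?f t) = ?F x"
  \<comment> \<open>Either way 0 is an endpoint, so the excluded point of the derivative formula is
    never interior. For negative \<open>x\<close> the integral is taken from \<open>x\<close> to 0
    and its sign reversed.\<close>
  proof (cases "0 \<le> x")
    case True
    have "(LBINT t=ereal 0..ereal x. ?f t) = ?F x - ?F 0"
      using True assms
      by (intro interval_integral_FTC_interior cont Li_Li_primitive_has_derivative) auto
    then show ?thesis using assms(2) by (simp add: Li_Li_primitive_0 zero_ereal_def)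
  next
    case False
    have "(LBINT t=ereal x..ereal 0. ?f t) = ?F 0 - ?F x"
      using False assms
      by (intro interval_integral_FTC_interior cont Li_Li_primitive_has_derivative) auto
    then show ?thesis
      using assms(2)
      by (subst interval_integral_endpoints_reverse) (simp add: Li_Li_primitive_0 zero_ereal_def)
  qed
  then show "(LBINT t=0..ereal x. ?f t) =
        (\<Sum>i=1..q-1. (-1) ^ (i - 1) * Li (p + i) x * Li (q + 1 - i) x)
        + (-1) ^ q * ln (1 - x) * (Li (p + q) x - zeta (real (p + q)))
        - (-1) ^ q * (\<Sum>n. 1 / real (Suc n) ^ (p + q) * (\<Sum>k=1..Suc n. x ^ k / real k))"
    by (simp only: Li_Li_primitive_def Li_Li_tail_def nested_sum_def algebra_simps)
qed

end
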